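(* Consider the normed space $(\mathbb{R}^2,\lVert\cdot\rVert_\infty)$ and the subset $C=\{r,p,q,u,v\}\subset\mathbb{R}^2$, where $$r=(1/2,0),\qquad p=(1,0),\qquad q=(0,0),\qquad u=(1,2),\qquad v=(0,1).$$ Define $T\colon C\to C$ by $$Tr=r,\qquad Tp=r,\qquad Tq=r,\qquad Tu=p,\qquad Tv=q.$$ Then $T$ is a $P$-contraction with constant $\beta=1/2$, but $T$ is not an enriched contraction.
   Context: Here $\lVert (s,t)\rVert_\infty=\max\{|s|,|t|\}$ on $\mathbb{R}^2$. Let $C$ be a nonempty subset of a normed linear space $(X,\lVert\cdot\rVert)$ and let $T:C\to C$ be a mapping. $T$ is called a $P$-contraction if there exists $\beta\in[0,1)$ such that for all $x,y\in C$, $$\lVert Tx-Ty\rVert\leq \beta\left(\lVert x-y\rVert+\bigl|\lVert x-Tx\rVert-\lVert y-Ty\rVert\bigr|\right);$$ it is a $P$-contraction with constant $\beta$ if this inequality holds for all $x,y\in C$ with that particular $\beta$. $T$ is called an enriched contraction if there exist constants $b\geq 0$ and $\theta\in[0,b+1)$ such that for all $x,y\in C$, $$\lVert b(x-y)+Tx-Ty\rVert\leq\theta\lVert x-y\rVert.$$ *)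

theory Defs
  imports Complex_Main "HOL-Library.FuncSet"
begin

text \<open>The plane with the maximum norm. A separate type is needed because the library's instances
  of the normed-space class on \<^typ>\<open>real \<times> real\<close> (and on \<open>real ^ 2\<close>) carry the Euclidean norm.\<close>

datatype plane = Pt (xcoord: real) (ycoord: real)

lemma plane_eq_iff: "z = w \<longleftrightarrow> xcoord z = xcoord w \<and> ycoord z = ycoord w"
  by (cases z; cases w) simp

instantiation plane :: real_vector
begin

definition zero_plane :: plane where
  "0 = Pt 0 0"

definition plus_plane :: "plane \<Rightarrow> plane \<Rightarrow> plane" where
  "z + w = Pt (xcoord z + xcoord w) (ycoord z + ycoord w)"

definition minus_plane :: "plane \<Rightarrow> plane \<Rightarrow> plane" where
  "z - w = Pt (xcoord z - xcoord w) (ycoord z - ycoord w)"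

definition uminus_plane :: "plane \<Rightarrow> plane" where
  "- z = Pt (- xcoord z) (- ycoord z)"

definition scaleR_plane :: "real \<Rightarrow> plane \<Rightarrow> plane" where
  "a *\<^sub>R z = Pt (a * xcoord z) (a * ycoord z)"

instance
  by standard
    (simp_all add: plane_eq_iff zero_plane_def plus_plane_def minus_plane_def uminus_plane_def
      scaleR_plane_def algebra_simps)

end

instantiation plane :: real_normed_vector
begin

definition norm_plane :: "plane \<Rightarrow> real" where
  "norm z = max \<bar>xcoord z\<bar> \<bar>ycoord z\<bar>"

definition sgn_plane :: "plane \<Rightarrow> plane" where
  "sgn (z::plane) = z /\<^sub>R norm z"

definition dist_plane :: "plane \<Rightarrow> plane \<Rightarrow> real" where
  "dist (z::plane) w = norm (z - w)"

definition uniformity_plane :: "(plane \<times> plane) filter" where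
  "uniformity = (INF e\<in>{0<..}. principal {(z::plane, w). dist z w < e})"

definition open_plane :: "plane set \<Rightarrow> bool" where
  "open (U::plane set) \<longleftrightarrow> (\<forall>z\<in>U. eventually (\<lambda>(z', w). z' = z \<longrightarrow> w \<in> U) uniformity)"

instance
proof
  fix z w :: plane and a :: real and U :: "plane set"
  show "sgn z = z /\<^sub>R norm z" by (rule sgn_plane_def)
  show "dist z w = norm (z - w)" by (rule dist_plane_def)
  show "(uniformity :: (plane \<times> plane) filter) = (INF e\<in>{0<..}. principal {(z, w). dist z w < e})"
    by (rule uniformity_plane_def)
  show "open U \<longleftrightarrow> (\<forall>z\<in>U. eventually (\<lambda>(z', w). z' = z \<longrightarrow> w \<in> U) uniformity)"
    by (rule open_plane_def)
  show "norm z = 0 \<longleftrightarrow> z = 0"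
    by (auto simp: norm_plane_def zero_plane_def plane_eq_iff max_def)
  show "norm (z + w) \<le> norm z + norm w"
    by (auto simp: norm_plane_def plus_plane_def)
  show "norm (a *\<^sub>R z) = \<bar>a\<bar> * norm z"
    by (simp add: norm_plane_def scaleR_plane_def abs_mult max_mult_distrib_left)
qed

end

text \<open>In the next two definitions \<open>C\<close> is meant to be nonempty and \<open>T\<close> to map \<open>C\<close> into itself.
  Both are standing assumptions on \<open>C\<close> and \<open>T\<close>, not part of the properties, so that the negation
  of a property denies exactly the existence of suitable constants.\<close>

definition P_contraction_with ::
    "real \<Rightarrow> 'a::real_normed_vector set \<Rightarrow> ('a \<Rightarrow> 'a) \<Rightarrow> bool" where
  "P_contraction_with \<beta> C T \<longleftrightarrow> 0 \<le> \<beta> \<and> \<beta> < 1 \<and>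
    (\<forall>x\<in>C. \<forall>y\<in>C. norm (T x - T y)
       \<le> \<beta> * (norm (x - y) + \<bar>norm (x - T x) - norm (y - T y)\<bar>))"

definition enriched_contraction :: "'a::real_normed_vector set \<Rightarrow> ('a \<Rightarrow> 'a) \<Rightarrow> bool" where
  "enriched_contraction C T \<longleftrightarrow>
    (\<exists>b \<theta>. 0 \<le> b \<and> 0 \<le> \<theta> \<and> \<theta> < b + 1 \<and>
      (\<forall>x\<in>C. \<forall>y\<in>C. norm (b *\<^sub>R (x - y) + T x - T y) \<le> \<theta> * norm (x - y)))"

end

theory Submission
  imports Defs
begin

text \<open>Everything hinges on the pair \<open>u\<close>, \<open>v\<close>: its distance and the
  distance of its images are both 1, but the displacements 2 and 1 differ by 1, so the P-bound holds
  with equality. In all other pairs of distinct points the images coincide or are 1/2 apart, with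
  the points at distance at least 1. Enriching cannot help: \<open>u - v\<close> and
  \<open>T u - T v\<close> attain their norms in the same coordinate with the same sign, so the
  norms add.\<close>

theorem theorem2p1:
  fixes r p q u v :: plane and C :: "plane set" and T :: "plane \<Rightarrow> plane"
  assumes "r = Pt (1/2) 0" and "p = Pt 1 0" and "q = Pt 0 0" and "u = Pt 1 2" and "v = Pt 0 1"
    and "C = {r, p, q, u, v}"
    and "T r = r" and "T p = r" and "T q = r" and "T u = p" and "T v = q"
  shows "T \<in> C \<rightarrow> C \<and> P_contraction_with (1/2) C T \<and> \<not> enriched_contraction C T"
proof (intro conjI)
  note points = assms(1-5)
  note T_values = assms(7-11)
  show "T \<in> C \<rightarrow> C"
    using T_values by (auto simp: assms(6))
  show "P_contraction_with (1/2) C T"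
    unfolding P_contraction_with_def assms(6)
    \<comment> \<open>\<open>T\<close> is evaluated while the points are still names, since
      \<open>T_values\<close> matches \<open>T u\<close> and not \<open>T (Pt 1 2)\<close>; a finite
      check in coordinates remains.\<close>
    by (simp add: T_values) (simp add: points norm_plane_def minus_plane_def)
  show "\<not> enriched_contraction C T"
  proof
    assume "enriched_contraction C T"
    then obtain b \<theta> where "0 \<le> b" "\<theta> < b + 1"
      and bound: "\<And>x y. x \<in> C \<Longrightarrow> y \<in> C \<Longrightarrow>
        norm (b *\<^sub>R (x - y) + T x - T y) \<le> \<theta> * norm (x - y)"
      unfolding enriched_contraction_def by blast
    have "norm (b *\<^sub>R (u - v) + T u - T v) \<le> \<theta> * norm (u - v)"
      by (rule bound) (simp_all add: assms(6))
    \<comment> \<open>The vector is b(1,1) + (1,0) = (b+1, b), and its first coordinate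
      dominates.\<close>
    moreover have "norm (b *\<^sub>R (u - v) + T u - T v) = b + 1"
      unfolding T_values using \<open>0 \<le> b\<close>
      by (simp add: points norm_plane_def minus_plane_def plus_plane_def scaleR_plane_def)
    moreover have "norm (u - v) = 1"
      by (simp add: points norm_plane_def minus_plane_def)
    ultimately show False
      using \<open>\<theta> < b + 1\<close> by simp
  qed
qed

end
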